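(* Let $c,\alpha,\beta>0$ be constants with $\beta>\frac{1-\alpha}{\alpha}$. Consider the generalized time-dependent Pólya urn process $(R_n,B_n)_{n\ge0}$ with weight function $w(n)=\exp(cn^\alpha)$, $n\in\mathbb N$, drawing sequence $\sigma_n=\lfloor n^\beta\rfloor$, $n\ge1$, and initial numbers $R_0,B_0\in\mathbb N$ of red and blue balls. Then $$\mathbb P(R_\infty<\infty\text{ or }B_\infty<\infty)=1.$$
   Context: $\mathbb N=\{0,1,2,\dots\}$. Generalized time-dependent Pólya urn (GPU) process: fix a non-decreasing $w:\mathbb N\to(0,\infty)$ and a sequence $(\sigma_n)_{n\ge1}$ of positive integers. The urn initially contains $R_0$ red and $B_0$ blue balls. At step $n+1$ ($n\ge0$), $\sigma_{n+1}$ new balls are added simultaneously, each being, independently, red with probability $\frac{w(R_n)}{w(R_n)+w(B_n)}$ and blue otherwise, where $R_n,B_n$ are the numbers of red and blue balls after $n$ steps. That is, conditionally on the past up to step $n$, $R_{n+1}-R_n$ is Binomial with parameters $\sigma_{n+1}$ and $\frac{w(R_n)}{w(R_n)+w(B_n)}$, and $B_{n+1}-B_n=\sigma_{n+1}-(R_{n+1}-R_n)$. Set $R_\infty=\lim_n R_n$ and $B_\infty=\lim_n B_n$ in $\mathbb N\cup\{\infty\}$. *)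

theory Defs
  imports "HOL-Probability.Probability"
begin

text \<open>
  A generalized time-dependent Polya urn process on an arbitrary probability space.
  The composition of the urn takes values in a countable set, so conditioning on the past up to
  step \<open>n\<close> is elementary conditioning on every history \<open>h\<close> of urn compositions
  (red, blue) that has positive probability. Almost sure rather than sure identities are required
  for the initial composition and for the total number of balls added.
\<close>

locale gpu_process = prob_space M
  for M :: "'a measure" +
  fixes w :: "nat \<Rightarrow> real"
    and \<sigma> :: "nat \<Rightarrow> nat"
    and R0 B0 :: nat
    and R B :: "nat \<Rightarrow> 'a \<Rightarrow> nat"
  assumes w_mono: "mono w"
    and w_pos: "\<And>n. w n > 0"
    and \<sigma>_pos: "\<And>n. n \<ge> 1 \<Longrightarrow> \<sigma> n > 0"
    and R_measurable: "\<And>n. R n \<in> measurable M (count_space UNIV)"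
    and B_measurable: "\<And>n. B n \<in> measurable M (count_space UNIV)"
    and init: "AE x in M. R 0 x = R0 \<and> B 0 x = B0"
    and red_step: "\<And>n h k.
        \<P>(x in M. \<forall>i\<le>n. (R i x, B i x) = h i) > 0 \<Longrightarrow>
        \<P>(x in M. R (Suc n) x = R n x + k \<bar> \<forall>i\<le>n. (R i x, B i x) = h i)
          = pmf (binomial_pmf (\<sigma> (Suc n)) (w (fst (h n)) / (w (fst (h n)) + w (snd (h n))))) k"
    and blue_step: "\<And>n. AE x in M.
        int (B (Suc n) x) - int (B n x)
          = int (\<sigma> (Suc n)) - (int (R (Suc n) x) - int (R n x))"

end

theory Submission
  imports Defs "HOL-Probability.Hoeffding" "HOL-Real_Asymp.Real_Asymp"
begin

text \<open>
  After \<open>n\<close> steps the urn holds about \<open>n powr (\<beta> + 1)\<close> balls, so with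
  \<open>\<kappa> = \<alpha> * (\<beta> + 1) - 1 > 0\<close> an imbalance \<open>\<bar>R n - B n\<bar> = d\<close> shifts the log-odds of the majority
  colour by at least a constant times \<open>n powr (\<kappa> - \<beta>) * d\<close>. One step, with about \<open>n powr \<beta>\<close> draws, thus
  amplifies the imbalance by a factor of order \<open>n powr \<kappa>\<close>, until it is comparable to
  \<open>n powr \<beta>\<close>. A single step already creates an imbalance of at least \<open>n powr \<theta>\<close> for any
  \<open>\<theta> < \<beta> / 2\<close>, except with vanishing probability, by a small-ball bound for the binomial distribution;
  finitely many amplification steps, controlled by Hoeffding's inequality, raise this to every
  \<open>\<theta> < \<beta>\<close>. If also \<open>\<theta> > \<beta> - \<kappa>\<close>, then from such an imbalance the minority colour receives a ball
  with summable probability, and when it does not, the imbalance persists. By Borel-Cantelli, almost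
  surely one colour eventually receives all balls.
\<close>

subsection \<open>Binomial and logistic estimates\<close>

lemma binomial_pmf_Suc_mult:
  fixes p :: real
  assumes p: "0 \<le> p" "p \<le> 1"
  shows "pmf (binomial_pmf n p) (Suc k) * (real (Suc k) * (1 - p)) =
         pmf (binomial_pmf n p) k * ((real n - real k) * p)"
proof (cases "k < n")
  case True
  have "real (n choose Suc k) * real (Suc k) = real (n choose k) * real (n - k)"
    by (metis binomial_absorb_comp mult.commute of_nat_mult binomial_absorption)
  moreover have "(1 - p) ^ (n - k) = (1 - p) ^ (n - Suc k) * (1 - p)"
    using True by (metis Suc_diff_Suc power_Suc2)
  ultimately have "real (n choose Suc k) * real (Suc k) * (p * p ^ k) * ((1 - p) ^ (n - Suc k) * (1 - p)) =
      real (n choose k) * real (n - k) * (p * p ^ k) * (1 - p) ^ (n - k)"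
    by simp
  then show ?thesis
    using p True by (simp add: of_nat_diff mult_ac del: of_nat_Suc)
next
  case False
  then have "k = n \<or> k > n" by auto
  then show ?thesis using p by (auto simp: binomial_eq_0)
qed

text \<open>
  Consecutive ratios of the probabilities near a mode \<open>m\<close> are close to 1, so about
  \<open>sqrt (n * p * (1 - p))\<close> values to the right of \<open>m\<close> have at least half the probability of \<open>m\<close>.
\<close>

lemma binomial_pmf_le:
  fixes p :: real
  assumes p: "0 < p" "p < 1"
  shows "pmf (binomial_pmf n p) k \<le> 3 / sqrt ((real n + 1) * p * (1 - p))"
proof -
  define f where "f = pmf (binomial_pmf n p)"
  define s where "s = (real n + 1) * p * (1 - p)"
  have s: "s > 0" using p by (simp add: s_def)
  have f_nonneg: "f i \<ge> 0" for i by (simp add: f_def)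
  have f_zero: "f i = 0" if "i > n" for i
    using that p by (simp add: f_def binomial_eq_0)
  have step: "f (Suc i) * (real (Suc i) * (1 - p)) = f i * ((real n - real i) * p)" for i
    unfolding f_def using p by (intro binomial_pmf_Suc_mult) auto
  obtain m where m: "m \<le> n" "\<And>i. i \<le> n \<Longrightarrow> f i \<le> f m"
  proof -
    have "Max (f ` {..n}) \<in> f ` {..n}" by (intro Max_in) auto
    then obtain m where "m \<in> {..n}" "Max (f ` {..n}) = f m" by (rule imageE)
    then show ?thesis using that[of m] Max_ge[of "f ` {..n}"] by auto
  qed
  have max: "f i \<le> f m" for i
    using m f_zero[of i] f_nonneg[of m] by (cases "i \<le> n") auto
  have fm: "f m > 0"
    using m(1) p by (simp add: f_def)
  \<comment> \<open>Comparing the mode with its left neighbour, and below with its right one,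
    locates \<open>(n + 1) * p\<close> between \<open>m\<close> and \<open>m + 1\<close>.\<close>
  have upper: "real m \<le> (real n + 1) * p"
  proof (cases m)
    case (Suc i)
    have "f m * (real m * (1 - p)) \<le> f m * ((real n - real i) * p)"
      unfolding Suc step using max[of i] m(1) p Suc by (intro mult_right_mono) auto
    then have "real m * (1 - p) \<le> (real n - real i) * p" using fm by simp
    then show ?thesis using Suc by (simp add: algebra_simps)
  qed (use p in auto)
  have lower: "(real n + 1) * p \<le> real m + 1"
  proof -
    have "f m * ((real n - real m) * p) \<le> f m * (real (Suc m) * (1 - p))"
      unfolding step[symmetric] using max[of "Suc m"] p by (intro mult_right_mono) auto
    then have "(real n - real m) * p \<le> real (Suc m) * (1 - p)" using fm by simp
    then show ?thesis by (simp add: algebra_simps)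
  qed
  \<comment> \<open>Passing from \<open>m + j\<close> to \<open>m + j + 1\<close> costs at most a
    factor \<open>1 - (j + 1) / s\<close>, by \<open>step\<close> and the location of
    \<open>m\<close>; the induction absorbs these factors into a quadratic bound.\<close>
  have decay: "f m * (1 - real j ^ 2 / s) \<le> f (m + j)" for j
  proof (induction j)
    case 0 show ?case by simp
  next
    case (Suc j)
    define d where "d = real (Suc (m + j)) * (1 - p)"
    have ds: "s \<le> d"
    proof -
      have "(real n + 1) * p * (1 - p) \<le> real (Suc (m + j)) * (1 - p)"
        using lower p by (intro mult_right_mono) auto
      then show ?thesis by (simp add: s_def d_def)
    qed
    have num: "d - (real j + 1) \<le> (real n - real (m + j)) * p"
      using upper p by (simp add: d_def algebra_simps)
    have "f (m + j) * (d - (real j + 1)) \<le> f (Suc (m + j)) * d"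
      unfolding d_def step using num f_nonneg by (intro mult_left_mono) (auto simp: d_def)
    then have A: "f (m + j) * (1 - (real j + 1) / d) \<le> f (Suc (m + j))"
      using ds s by (simp add: field_simps)
    have "(real j + 1) / d \<le> (real j + 1) / s"
      using ds s by (intro divide_left_mono) auto
    then have B: "f (m + j) * (1 - (real j + 1) / s) \<le> f (Suc (m + j))"
      using A mult_left_mono[of "1 - (real j + 1) / s" "1 - (real j + 1) / d" "f (m+j)"] f_nonneg[of "m+j"]
      by auto
    show ?case
    proof (cases "real j + 1 \<le> s")
      case True
      have "f m * (1 - real (Suc j) ^ 2 / s) \<le> f m * ((1 - real j ^ 2 / s) * (1 - (real j + 1) / s))"
      proof (intro mult_left_mono)
        have "0 \<le> real j ^ 2 / s * ((real j + 1) / s) + real j / s" using s by auto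
        then show "1 - real (Suc j) ^ 2 / s \<le> (1 - real j ^ 2 / s) * (1 - (real j + 1) / s)"
          by (simp add: power2_eq_square algebra_simps add_divide_distrib)
      qed (use fm in auto)
      also have "\<dots> \<le> f (m + j) * (1 - (real j + 1) / s)"
        unfolding mult.assoc[symmetric] using Suc.IH True s by (intro mult_right_mono) auto
      finally show ?thesis using B by simp
    next
      \<comment> \<open>Here the claimed lower bound is nonpositive.\<close>
      case False
      then have "s \<le> real (Suc j) ^ 2" by (simp add: power2_eq_square algebra_simps) 
         (smt (verit) mult_nonneg_nonneg of_nat_0_le_iff)
      then have "1 - real (Suc j) ^ 2 / s \<le> 0" using s by simp
      then show ?thesis using fm f_nonneg[of "m + Suc j"]
        by (meson dual_order.trans less_imp_le mult_nonneg_nonpos)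
    qed
  qed
  \<comment> \<open>Up to \<open>J\<close> the loss \<open>j ^ 2 / s\<close> is at most
    \<open>1 / 2\<close>; these are \<open>J + 1 \<ge> sqrt (s / 2)\<close> points of total
    probability at most 1.\<close>
  define J where "J = nat \<lfloor>sqrt (s / 2)\<rfloor>"
  have J: "real J \<le> sqrt (s / 2)" "sqrt (s / 2) \<le> real J + 1"
    using s by (auto simp: J_def)
  have half: "f m / 2 \<le> f (m + j)" if "j \<le> J" for j
  proof -
    have "real j ^ 2 \<le> sqrt (s / 2) ^ 2" using that J by (intro power_mono) auto
    then have "real j ^ 2 / s \<le> 1 / 2" using s by (simp add: field_simps)
    then have "f m * (1 / 2) \<le> f m * (1 - real j ^ 2 / s)" using fm by (intro mult_left_mono) auto
    then show ?thesis using decay[of j] by linarith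
  qed
  have "(real J + 1) * (f m / 2) = (\<Sum>j\<le>J. f m / 2)" by simp
  also have "\<dots> \<le> (\<Sum>j\<le>J. f (m + j))" by (intro sum_mono half) auto
  also have "\<dots> = (\<Sum>i\<in>(+) m ` {..J}. f i)" by (subst sum.reindex) auto
  also have "\<dots> = measure_pmf.prob (binomial_pmf n p) ((+) m ` {..J})"
    unfolding f_def by (subst measure_measure_pmf_finite) auto
  also have "\<dots> \<le> 1" by simp
  finally have "(real J + 1) * f m \<le> 2" by simp
  moreover have "sqrt (s / 2) * f m \<le> (real J + 1) * f m" using J fm by (intro mult_right_mono) auto
  ultimately have "sqrt s / sqrt 2 * f m \<le> 2" unfolding real_sqrt_divide by linarith
  then have "f m * sqrt s \<le> 2 * sqrt 2" by (simp add: field_simps)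
  also have "\<dots> \<le> 3" by (rule power2_le_imp_le) (auto simp: power_mult_distrib)
  finally have "f m \<le> 3 / sqrt s" using s by (simp add: field_simps)
  then show ?thesis using max[of k] unfolding f_def s_def by simp
qed

section \<open>Power differences and the logistic function\<close>

text \<open>For \<open>\<alpha> \<ge> 1\<close> use
  \<open>b powr (\<alpha> - 1) \<le> r powr (\<alpha> - 1)\<close> and
  \<open>r \<ge> (r + b) / 2\<close>; for \<open>\<alpha> < 1\<close> the mean value theorem and
  \<open>r \<le> r + b\<close>. The bound is phrased through \<open>r + b\<close> because the urn
  size is deterministic.\<close>

lemma powr_diff_ge:
  fixes r b \<alpha> :: real
  assumes "0 \<le> b" "b \<le> r" "r > 0" "\<alpha> > 0"
  shows "min \<alpha> (2 powr (1 - \<alpha>)) * (r + b) powr (\<alpha> - 1) * (r - b) \<le> r powr \<alpha> - b powr \<alpha>"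
proof (cases "\<alpha> \<ge> 1")
  case True
  have "min \<alpha> (2 powr (1 - \<alpha>)) * (r + b) powr (\<alpha> - 1) \<le> 2 powr (1 - \<alpha>) * (r + b) powr (\<alpha> - 1)"
    by (intro mult_right_mono) auto
  also have "\<dots> = ((r + b) / 2) powr (\<alpha> - 1)"
    using assms by (simp add: powr_divide powr_diff field_simps)
  also have "\<dots> \<le> r powr (\<alpha> - 1)"
    using assms True by (intro powr_mono2) auto
  finally have "min \<alpha> (2 powr (1 - \<alpha>)) * (r + b) powr (\<alpha> - 1) * (r - b) \<le> r powr (\<alpha> - 1) * (r - b)"
    using assms by (intro mult_right_mono) auto
  also have "\<dots> = r powr \<alpha> - r powr (\<alpha> - 1) * b"
    using assms by (simp add: powr_diff field_simps)
  also have "r powr (\<alpha> - 1) * b \<ge> b powr (\<alpha> - 1) * b"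
    using assms True by (intro mult_right_mono powr_mono2) auto
  moreover have "b powr (\<alpha> - 1) * b = b powr \<alpha>"
    using assms by (cases "b = 0") (auto simp: powr_diff)
  ultimately show ?thesis by simp
next
  case False
  have "min \<alpha> (2 powr (1 - \<alpha>)) * (r + b) powr (\<alpha> - 1) \<le> \<alpha> * r powr (\<alpha> - 1)"
    using assms False by (intro mult_mono powr_mono2') auto
  then have "min \<alpha> (2 powr (1 - \<alpha>)) * (r + b) powr (\<alpha> - 1) * (r - b) \<le> \<alpha> * r powr (\<alpha> - 1) * (r - b)"
    using assms by (intro mult_right_mono) auto
  also have "\<dots> \<le> r powr \<alpha> - b powr \<alpha>"
  proof -
    \<comment> \<open>The case \<open>b = 0\<close> is separate because for
      \<open>\<alpha> < 1\<close> the power has no derivative there.\<close>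
    consider "b = 0" | "b = r" | "0 < b" "b < r" using assms by linarith
    then show ?thesis
    proof cases
      case 1
      have "\<alpha> * r powr \<alpha> \<le> 1 * r powr \<alpha>" using False by (intro mult_right_mono) auto
      then show ?thesis using 1 assms by (simp add: powr_diff)
    next
      case 3
      have "\<exists>z>b. z < r \<and> r powr \<alpha> - b powr \<alpha> = (r - b) * (\<alpha> * z powr (\<alpha> - 1))"
        using 3 by (intro MVT2) (auto intro!: derivative_eq_intros simp: powr_diff field_simps)
      then obtain z where z: "b < z" "z < r" "r powr \<alpha> - b powr \<alpha> = (r - b) * (\<alpha> * z powr (\<alpha> - 1))"
        by blast
      have "r powr (\<alpha> - 1) \<le> z powr (\<alpha> - 1)" using z 3 False by (intro powr_mono2') auto
      then have "(r - b) * (\<alpha> * r powr (\<alpha> - 1)) \<le> (r - b) * (\<alpha> * z powr (\<alpha> - 1))"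
        using assms by (intro mult_left_mono) auto
      then show ?thesis using z by (simp add: mult_ac)
    qed auto
  qed
  finally show ?thesis .
qed

text \<open>Capping at 1 allows the linear bound \<open>exp (- y) \<le> 1 - y / 2\<close>; the
  tangent of \<open>1 / (2 - u)\<close> at 0, taken at \<open>u = y / 2\<close>, then gives the
  slope \<open>1 / 8\<close>.\<close>

lemma logistic_ge:
  fixes z :: real
  assumes "z \<ge> 0"
  shows "1 / (1 + exp (- z)) \<ge> 1 / 2 + min 1 z / 8"
proof -
  define y where "y = min 1 z"
  have y: "0 \<le> y" "y \<le> 1" "y \<le> z" using assms by (auto simp: y_def)
  have "1 + y \<le> exp y" by (rule exp_ge_add_one_self)
  then have "exp (- y) \<le> 1 / (1 + y)" using y by (simp add: exp_minus field_simps)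
  also have "\<dots> \<le> 1 - y / 2"
  proof -
    have "y * y \<le> y * 1" using y by (intro mult_left_mono) auto
    then show ?thesis using y by (simp add: field_simps)
  qed
  finally have e: "exp (- z) \<le> 1 - y / 2" using y by (smt (verit) exp_le_cancel_iff)
  have "1 / (1 + exp (- z)) \<ge> 1 / (2 - y / 2)"
    using e y by (intro divide_left_mono) (auto intro!: mult_pos_pos add_pos_pos)
  moreover have "1 / (2 - y / 2) \<ge> 1 / 2 + y / 8"
    using y by (simp add: field_simps)
  ultimately show ?thesis by (simp add: y_def)
qed

lemma logistic_compl_le: "1 - 1 / (1 + exp (- z)) \<le> exp (- z :: real)"
proof -
  have p: "1 + exp (- z) > 0" by (simp add: add_pos_pos)
  then have "1 - 1 / (1 + exp (- z)) = exp (- z) / (1 + exp (- z))" by (simp add: field_simps)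
  also have "\<dots> \<le> exp (- z)" using p by (simp add: divide_le_eq)
  finally show ?thesis .
qed

section \<open>Binomial bounds for the imbalance after one step\<close>

text \<open>With \<open>d\<close> the current imbalance and \<open>k\<close> red balls among
  \<open>s\<close> draws, \<open>d + 2 * k - s\<close> is the next imbalance. Its mean is at least
  \<open>2 * g * s\<close> away from 0 on the side of \<open>d\<close>, so a value below
  \<open>g * s\<close> puts \<open>k\<close> at least \<open>g * s / 2\<close> off its mean, and
  Hoeffding applies. At \<open>d = 0\<close> both hypotheses hold and force
  \<open>g = 0\<close>.\<close>

lemma binomial_advantage:
  fixes p g d :: real
  assumes p: "0 \<le> p" "p \<le> 1" and s: "s > 0" and g: "g \<ge> 0"
    and pos: "d \<ge> 0 \<Longrightarrow> p \<ge> 1 / 2 + g" and neg: "d \<le> 0 \<Longrightarrow> p \<le> 1 / 2 - g"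
  shows "measure_pmf.prob (binomial_pmf s p) {k. \<bar>d + 2 * real k - real s\<bar> < g * real s}
           \<le> 2 * exp (- (g\<^sup>2 * real s / 2))"
proof -
  interpret binomial_distribution s p using p by unfold_locales auto
  have "measure_pmf.prob (binomial_pmf s p) {k. \<bar>d + 2 * real k - real s\<bar> < g * real s}
      \<le> measure_pmf.prob (binomial_pmf s p) {k. \<bar>real k - real s * p\<bar> \<ge> g * real s / 2}"
  proof (intro measure_pmf.finite_measure_mono subsetI)
    fix k assume k: "k \<in> {k. \<bar>d + 2 * real k - real s\<bar> < g * real s}"
    have "\<bar>real k - real s * p\<bar> \<ge> g * real s / 2"
    proof (cases "d \<ge> 0")
      case True
      have "real s * p \<ge> real s * (1 / 2 + g)" using pos[OF True] by (intro mult_left_mono) auto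
      then show ?thesis using k True by (simp add: algebra_simps abs_if split: if_splits)
    next
      case False
      have "real s * p \<le> real s * (1 / 2 - g)" using neg False by (intro mult_left_mono) auto
      then show ?thesis using k False by (simp add: algebra_simps abs_if split: if_splits)
    qed
    then show "k \<in> {k. \<bar>real k - real s * p\<bar> \<ge> g * real s / 2}" by simp
  qed auto
  also have "\<dots> \<le> 2 * exp (- 2 * (g * real s / 2)\<^sup>2 / real s)"
    using s g by (intro prob_abs_ge) auto
  also have "- 2 * (g * real s / 2)\<^sup>2 / real s = - (g\<^sup>2 * real s / 2)"
    using s by (simp add: power2_eq_square field_simps)
  finally show ?thesis .
qed

text \<open>The condition confines \<open>k\<close> to an interval of length \<open>t\<close>, hence
  to at most \<open>t + 1\<close> values, and for \<open>p\<close> in this range each value has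
  probability at most \<open>7 / sqrt s\<close>.\<close>

lemma binomial_small_ball:
  fixes p d t :: real
  assumes p: "1 / 4 \<le> p" "p \<le> 3 / 4" and s: "s > 0" and t: "t \<ge> 0"
  shows "measure_pmf.prob (binomial_pmf s p) {k. \<bar>d + 2 * real k - real s\<bar> < t}
           \<le> 7 * (t + 1) / sqrt (real s)"
proof -
  define K where "K = {k::nat. \<bar>d + 2 * real k - real s\<bar> < t}"
  define l u where "l = (real s - d - t) / 2" and "u = (real s - d + t) / 2"
  have sub: "int ` K \<subseteq> {\<lfloor>l\<rfloor><..\<lceil>u\<rceil> - 1}"
  proof
    fix i assume "i \<in> int ` K"
    then obtain k where k: "i = int k" "k \<in> K" by auto
    then have "l < real k" "real k < u" unfolding K_def l_def u_def by (simp_all add: abs_less_iff)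
    then show "i \<in> {\<lfloor>l\<rfloor><..\<lceil>u\<rceil> - 1}" using k by (simp add: floor_less_iff less_ceiling_iff)
  qed
  then have fin: "finite K" using finite_subset finite_imageD inj_on_of_nat
    by (metis finite_greaterThanAtMost_int)
  have "card K = card (int ` K)" by (simp add: card_image)
  also have "\<dots> \<le> card {\<lfloor>l\<rfloor><..\<lceil>u\<rceil> - 1}" using sub by (intro card_mono) auto
  also have "\<dots> = nat (\<lceil>u\<rceil> - 1 - \<lfloor>l\<rfloor>)" by simp
  finally have "real (card K) \<le> real (nat (\<lceil>u\<rceil> - 1 - \<lfloor>l\<rfloor>))" by simp
  also have "\<dots> \<le> u - l + 1"
  proof -
    have "real_of_int (\<lceil>u\<rceil> - 1 - \<lfloor>l\<rfloor>) \<le> u - l + 1" by linarith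
    moreover have "0 \<le> u - l + 1" using t by (simp add: l_def u_def field_simps)
    ultimately show ?thesis by (cases "0 \<le> \<lceil>u\<rceil> - 1 - \<lfloor>l\<rfloor>") auto
  qed
  also have "u - l = t" by (simp add: l_def u_def field_simps)
  finally have card: "real (card K) \<le> t + 1" .
  have pmf: "pmf (binomial_pmf s p) k \<le> 7 / sqrt (real s)" for k
  proof -
    have "0 \<le> (p - 1 / 4) * (3 / 4 - p)" using p by (intro mult_nonneg_nonneg) auto
    then have pq: "3 / 16 \<le> p * (1 - p)" by (simp add: field_simps)
    \<comment> \<open>The constant 7 works because
      \<open>p * (1 - p) \<ge> 3 / 16 \<ge> (3 / 7) ^ 2\<close>.\<close>
    have "(3 / 7)\<^sup>2 * real s \<le> (real s + 1) * (3 / 16)" using s by (simp add: power2_eq_square)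
    also have "\<dots> \<le> (real s + 1) * (p * (1 - p))" using pq by (intro mult_left_mono) auto
    finally have "sqrt ((3 / 7)\<^sup>2 * real s) \<le> sqrt ((real s + 1) * p * (1 - p))"
      by (simp add: mult.assoc)
    then have "3 / 7 * sqrt (real s) \<le> sqrt ((real s + 1) * p * (1 - p))"
      by (simp add: real_sqrt_mult)
    moreover have "0 < 3 / 7 * sqrt (real s)" using s by simp
    ultimately have "3 / sqrt ((real s + 1) * p * (1 - p)) \<le> 3 / (3 / 7 * sqrt (real s))"
      by (intro divide_left_mono mult_pos_pos) linarith+
    then show ?thesis using binomial_pmf_le[of p s k] p by simp
  qed
  have "measure_pmf.prob (binomial_pmf s p) K = (\<Sum>k\<in>K. pmf (binomial_pmf s p) k)"
    using fin by (rule measure_measure_pmf_finite)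
  also have "\<dots> \<le> (\<Sum>k\<in>K. 7 / sqrt (real s))" by (intro sum_mono pmf)
  also have "\<dots> = real (card K) * (7 / sqrt (real s))" by simp
  also have "\<dots> \<le> (t + 1) * (7 / sqrt (real s))" using card by (intro mult_right_mono) auto
  finally show ?thesis by (simp add: K_def mult_ac)
qed

text \<open>A union bound over the draws, obtained from Bernoulli's inequality.\<close>

lemma binomial_prob_not_all:
  fixes p :: real
  assumes "0 \<le> p" "p \<le> 1"
  shows "measure_pmf.prob (binomial_pmf s p) {k. k \<noteq> s} \<le> real s * (1 - p)"
    and "measure_pmf.prob (binomial_pmf s p) {k. k \<noteq> 0} \<le> real s * p"
proof -
  have compl: "measure_pmf.prob (binomial_pmf s p) {k. k \<noteq> j} = 1 - pmf (binomial_pmf s p) j" for j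
  proof -
    have "{k. k \<noteq> j} = - {j}" by auto
    then show ?thesis
      using measure_pmf.prob_compl[of "{j}" "binomial_pmf s p"] by (simp add: measure_pmf_single Compl_eq_Diff_UNIV)
  qed
  have "1 + real s * (p - 1) \<le> (1 + (p - 1)) ^ s" by (rule Bernoulli_inequality) (use assms in auto)
  then show "measure_pmf.prob (binomial_pmf s p) {k. k \<noteq> s} \<le> real s * (1 - p)"
    unfolding compl using assms by (simp add: algebra_simps)
  have "1 + real s * (- p) \<le> (1 + (- p)) ^ s" by (rule Bernoulli_inequality) (use assms in auto)
  then show "measure_pmf.prob (binomial_pmf s p) {k. k \<noteq> 0} \<le> real s * p"
    unfolding compl using assms by (simp add: algebra_simps)
qed

subsection \<open>One step of the urn\<close>

text \<open>Separates the events of two histories that differ at some time, with \<open>f\<close>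
  the state at that time.\<close>

lemma fibres_disjoint:
  assumes "A \<subseteq> {x. f x = a}" "C \<subseteq> {x. f x = b}" "a \<noteq> b"
  shows "A \<inter> C = {}"
  using assms by blast

context gpu_process
begin

lemmas process_measurable [measurable] = R_measurable B_measurable

text \<open>The four ball counts take countably many values, so an arbitrary predicate
  \<open>P\<close> gives a countable union of events.\<close>

lemma sets_state_pred [measurable]: "{x\<in>space M. P (R m x) (B m x) (R n x) (B n x)} \<in> events"
proof -
  have "{x\<in>space M. P (R m x) (B m x) (R n x) (B n x)} =
      {x\<in>space M. \<exists>a b c d. P a b c d \<and> R m x = a \<and> B m x = b \<and> R n x = c \<and> B n x = d}"
    by auto
  also have "\<dots> \<in> events" by measurable
  finally show ?thesis .
qed

definition red_prob :: "nat \<Rightarrow> nat \<Rightarrow> real" where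
  "red_prob r b = w r / (w r + w b)"

definition total :: "nat \<Rightarrow> nat" where
  "total n = R0 + B0 + (\<Sum>i=1..n. \<sigma> i)"

lemma red_prob_pos: "red_prob r b > 0" and red_prob_less_1: "red_prob r b < 1"
  using w_pos[of r] w_pos[of b] by (auto simp: red_prob_def)

text \<open>Law of total probability over the histories up to \<open>n\<close>: the integral is a
  countable sum, and \<open>PiE\<close> represents each history exactly once. The increment is an
  existential \<open>k\<close> because \<open>R n x \<le> R (Suc n) x\<close> is only derived from
  this lemma.\<close>

lemma emeasure_step:
  "emeasure M {x\<in>space M. \<exists>k. R (Suc n) x = R n x + k \<and> Q (R n x) (B n x) k} =
     (\<integral>\<^sup>+h. emeasure M {x\<in>space M. \<forall>i\<le>n. (R i x, B i x) = h i} *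
        emeasure (measure_pmf (binomial_pmf (\<sigma> (Suc n)) (red_prob (fst (h n)) (snd (h n)))))
          {k. Q (fst (h n)) (snd (h n)) k}
      \<partial>count_space (PiE {..n} (\<lambda>_. UNIV)))"
proof -
  let ?H = "PiE {..n} (\<lambda>_. UNIV) :: (nat \<Rightarrow> nat \<times> nat) set"
  let ?C = "\<lambda>h. {x\<in>space M. \<forall>i\<le>n. (R i x, B i x) = h i}"
  let ?K = "\<lambda>h. {k. Q (fst (h n)) (snd (h n)) k}"
  let ?D = "\<lambda>h k. {x\<in>space M. R (Suc n) x = R n x + k \<and> (\<forall>i\<le>n. (R i x, B i x) = h i)}"
  have split: "{x\<in>space M. \<exists>k. R (Suc n) x = R n x + k \<and> Q (R n x) (B n x) k} =
      (\<Union>h\<in>?H. \<Union>k\<in>?K h. ?D h k)"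
  proof (intro equalityI subsetI)
    fix x assume "x \<in> {x\<in>space M. \<exists>k. R (Suc n) x = R n x + k \<and> Q (R n x) (B n x) k}"
    then obtain k where k: "x \<in> space M" "R (Suc n) x = R n x + k" "Q (R n x) (B n x) k" by auto
    show "x \<in> (\<Union>h\<in>?H. \<Union>k\<in>?K h. ?D h k)"
      by (rule UN_I[of "restrict (\<lambda>i. (R i x, B i x)) {..n}"]) (use k in auto)
  next
    fix x assume "x \<in> (\<Union>h\<in>?H. \<Union>k\<in>?K h. ?D h k)"
    then obtain h k where "Q (fst (h n)) (snd (h n)) k" "x \<in> ?D h k" by auto
    moreover then have "h n = (R n x, B n x)" by (metis (mono_tags, lifting) mem_Collect_eq order_refl)
    ultimately show "x \<in> {x\<in>space M. \<exists>k. R (Suc n) x = R n x + k \<and> Q (R n x) (B n x) k}" by auto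
  qed
  have D_sets: "?D h k \<in> events" for h k by measurable
  have C_sets: "?C h \<in> events" for h by measurable
  \<comment> \<open>\<open>red_step\<close> speaks of histories of positive probability; for the
    others both sides are 0.\<close>
  have D: "emeasure M (?D h k) = emeasure M (?C h) *
      pmf (binomial_pmf (\<sigma> (Suc n)) (red_prob (fst (h n)) (snd (h n)))) k" for h k
  proof (cases "prob (?C h) > 0")
    case True
    then have "prob (?D h k) = prob (?C h) * pmf (binomial_pmf (\<sigma> (Suc n)) (red_prob (fst (h n)) (snd (h n)))) k"
      using red_step[of n h k] unfolding red_prob_def cond_prob_def by (simp add: field_simps)
    then show ?thesis by (simp add: emeasure_eq_measure ennreal_mult)
  next
    case False
    then have "prob (?C h) = 0" by (simp add: zero_less_measure_iff)
    moreover have "prob (?D h k) \<le> prob (?C h)" by (intro finite_measure_mono C_sets) blast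
    ultimately have "prob (?D h k) = 0" "prob (?C h) = 0" by (auto simp: measure_le_0_iff)
    then show ?thesis by (simp add: emeasure_eq_measure)
  qed
  have "emeasure M (\<Union>h\<in>?H. \<Union>k\<in>?K h. ?D h k) = (\<integral>\<^sup>+h. emeasure M (\<Union>k\<in>?K h. ?D h k) \<partial>count_space ?H)"
  proof (intro emeasure_UN_countable)
    show "disjoint_family_on (\<lambda>h. \<Union>k\<in>?K h. ?D h k) ?H"
    proof (unfold disjoint_family_on_def, intro ballI impI)
      fix g h assume "g \<in> ?H" "h \<in> ?H" "g \<noteq> h"
      then obtain i where "i \<le> n" "g i \<noteq> h i" using PiE_ext[of g "{..n}" "\<lambda>_. UNIV" h] by (metis atMost_iff)
      have "(\<Union>k\<in>?K f. ?D f k) \<subseteq> {x. (R i x, B i x) = f i}" for f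
        using \<open>i \<le> n\<close> by (intro UN_least subsetI CollectI) simp
      from this[of g] this[of h] show "(\<Union>k\<in>?K g. ?D g k) \<inter> (\<Union>k\<in>?K h. ?D h k) = {}"
        using \<open>g i \<noteq> h i\<close> by (rule fibres_disjoint)
    qed
    show "countable ?H" by (intro countable_PiE) auto
    fix h
    show "(\<Union>k\<in>?K h. ?D h k) \<in> events" by (intro sets.countable_UN'' D_sets) auto
  qed
  also have "\<dots> = (\<integral>\<^sup>+h. emeasure M (?C h) *
        emeasure (measure_pmf (binomial_pmf (\<sigma> (Suc n)) (red_prob (fst (h n)) (snd (h n))))) (?K h) \<partial>count_space ?H)"
  proof (intro nn_integral_cong)
    fix h
    have "emeasure M (\<Union>k\<in>?K h. ?D h k) = (\<integral>\<^sup>+k. emeasure M (?D h k) \<partial>count_space (?K h))"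
      by (intro emeasure_UN_countable D_sets) (auto simp: disjoint_family_on_def)
    also have "\<dots> = emeasure M (?C h) *
        (\<integral>\<^sup>+k. pmf (binomial_pmf (\<sigma> (Suc n)) (red_prob (fst (h n)) (snd (h n)))) k \<partial>count_space (?K h))"
      unfolding D by (rule nn_integral_cmult) simp
    finally show "emeasure M (\<Union>k\<in>?K h. ?D h k) = emeasure M (?C h) *
        emeasure (measure_pmf (binomial_pmf (\<sigma> (Suc n)) (red_prob (fst (h n)) (snd (h n))))) (?K h)"
      by (simp add: nn_integral_pmf)
  qed
  finally show ?thesis unfolding split .
qed

text \<open>The histories partition the space. This lets a bound uniform in the history pass through
  \<open>emeasure_step\<close>.\<close>

lemma nn_integral_history:
  "(\<integral>\<^sup>+h. emeasure M {x\<in>space M. \<forall>i\<le>n. (R i x, B i x) = h i} \<partial>count_space (PiE {..n} (\<lambda>_. UNIV))) = 1"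
proof -
  let ?H = "PiE {..n} (\<lambda>_. UNIV) :: (nat \<Rightarrow> nat \<times> nat) set"
  let ?C = "\<lambda>h. {x\<in>space M. \<forall>i\<le>n. (R i x, B i x) = h i}"
  have "(\<Union>h\<in>?H. ?C h) = space M"
  proof (intro equalityI subsetI)
    fix x assume "x \<in> space M"
    then show "x \<in> (\<Union>h\<in>?H. ?C h)"
      by (intro UN_I[of "restrict (\<lambda>i. (R i x, B i x)) {..n}"]) auto
  qed auto
  moreover have "emeasure M (\<Union>h\<in>?H. ?C h) = (\<integral>\<^sup>+h. emeasure M (?C h) \<partial>count_space ?H)"
  proof (intro emeasure_UN_countable)
    show "disjoint_family_on ?C ?H"
    proof (unfold disjoint_family_on_def, intro ballI impI)
      fix g h assume "g \<in> ?H" "h \<in> ?H" "g \<noteq> h"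
      then obtain i where "i \<le> n" "g i \<noteq> h i" using PiE_ext[of g "{..n}" "\<lambda>_. UNIV" h] by (metis atMost_iff)
      have "?C f \<subseteq> {x. (R i x, B i x) = f i}" for f
        using \<open>i \<le> n\<close> by (intro subsetI CollectI) simp
      from this[of g] this[of h] show "?C g \<inter> ?C h = {}"
        using \<open>g i \<noteq> h i\<close> by (rule fibres_disjoint)
    qed
  qed (auto intro!: countable_PiE)
  ultimately show ?thesis by (simp add: emeasure_space_1)
qed

text \<open>After every history the binomial law gives mass 1 to
  \<open>k \<le> \<sigma> (Suc n)\<close>.\<close>

lemma AE_red_increment: "AE x in M. R n x \<le> R (Suc n) x \<and> R (Suc n) x - R n x \<le> \<sigma> (Suc n)"
proof -
  have "emeasure (measure_pmf (binomial_pmf (\<sigma> (Suc n)) (red_prob r b))) {k. k \<le> \<sigma> (Suc n)} = 1" for r b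
    using red_prob_pos[of r b] red_prob_less_1[of r b]
    by (intro measure_pmf.emeasure_eq_1_AE) (auto simp: AE_measure_pmf_iff)
  then have "emeasure M {x\<in>space M. \<exists>k. R (Suc n) x = R n x + k \<and> k \<le> \<sigma> (Suc n)} = 1"
    unfolding emeasure_step[of n "\<lambda>r b k. k \<le> \<sigma> (Suc n)"] by (simp add: nn_integral_history)
  then have "prob {x\<in>space M. \<exists>k. R (Suc n) x = R n x + k \<and> k \<le> \<sigma> (Suc n)} = 1"
    by (simp add: measure_def)
  then have "AE x in M. \<exists>k. R (Suc n) x = R n x + k \<and> k \<le> \<sigma> (Suc n)"
    by (subst (asm) prob_Collect_eq_1)
       (rule sets_state_pred[of "\<lambda>r _ s _. \<exists>k. s = r + k \<and> k \<le> \<sigma> (Suc n)" n "Suc n"])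
  then show ?thesis by eventually_elim auto
qed

text \<open>As the red increment lies between 0 and \<open>\<sigma> (Suc n)\<close>, the integer
  identity \<open>blue_step\<close> turns into one with natural subtraction; summing the steps gives
  the urn size.\<close>

lemma AE_regular:
  "AE x in M. \<forall>n. R n x \<le> R (Suc n) x \<and> R (Suc n) x - R n x \<le> \<sigma> (Suc n) \<and>
     B (Suc n) x = B n x + (\<sigma> (Suc n) - (R (Suc n) x - R n x)) \<and> R n x + B n x = total n"
proof -
  have "AE x in M. \<forall>n. R n x \<le> R (Suc n) x \<and> R (Suc n) x - R n x \<le> \<sigma> (Suc n)"
    unfolding AE_all_countable using AE_red_increment by blast
  moreover have "AE x in M. \<forall>n. int (B (Suc n) x) - int (B n x)
      = int (\<sigma> (Suc n)) - (int (R (Suc n) x) - int (R n x))"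
    unfolding AE_all_countable using blue_step by blast
  ultimately show ?thesis using init
  proof eventually_elim
    case (elim x)
    have "B (Suc n) x = B n x + (\<sigma> (Suc n) - (R (Suc n) x - R n x))" for n
      using elim(1)[rule_format, of n] elim(2)[rule_format, of n] by linarith
    moreover have "R n x + B n x = total n" for n
    proof (induction n)
      case (Suc n)
      have "R (Suc n) x + B (Suc n) x = R n x + B n x + \<sigma> (Suc n)"
        using elim(1)[rule_format, of n] elim(2)[rule_format, of n] by linarith
      then show ?case using Suc by (simp add: total_def)
    qed (use elim(3) in \<open>simp add: total_def\<close>)
    ultimately show ?case using elim(1) by blast
  qed
qed

text \<open>A bound valid in every state of size \<open>total n\<close> survives averaging over the
  histories.\<close>

lemma prob_step_le:
  assumes Q: "\<And>r b. r + b = total n \<Longrightarrow>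
      measure_pmf.prob (binomial_pmf (\<sigma> (Suc n)) (red_prob r b)) {k. Q r b k} \<le> f"
    and f: "f \<ge> 0"
  shows "\<P>(x in M. Q (R n x) (B n x) (R (Suc n) x - R n x)) \<le> f"
proof -
  \<comment> \<open>With the size built into the event, histories ending in a state of another size
    contribute 0.\<close>
  let ?Q = "\<lambda>r b k. r + b = total n \<and> Q r b k"
  have "emeasure M {x\<in>space M. \<exists>k. R (Suc n) x = R n x + k \<and> ?Q (R n x) (B n x) k} \<le>
     (\<integral>\<^sup>+h. emeasure M {x\<in>space M. \<forall>i\<le>n. (R i x, B i x) = h i} * ennreal f
      \<partial>count_space (PiE {..n} (\<lambda>_. UNIV)))"
    unfolding emeasure_step[of n ?Q]
  proof (intro nn_integral_mono mult_left_mono)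
    fix h :: "nat \<Rightarrow> nat \<times> nat"
    show "emeasure (measure_pmf (binomial_pmf (\<sigma> (Suc n)) (red_prob (fst (h n)) (snd (h n)))))
          {k. ?Q (fst (h n)) (snd (h n)) k} \<le> ennreal f"
      using Q[of "fst (h n)" "snd (h n)"] f
      by (cases "fst (h n) + snd (h n) = total n")
         (auto simp: measure_pmf.emeasure_eq_measure intro: ennreal_leI)
  qed auto
  also have "\<dots> = ennreal f"
    by (subst nn_integral_multc) (auto simp: nn_integral_history)
  finally have "prob {x\<in>space M. \<exists>k. R (Suc n) x = R n x + k \<and> ?Q (R n x) (B n x) k} \<le> f"
    using f by (simp add: emeasure_eq_measure)
  moreover have "prob {x\<in>space M. Q (R n x) (B n x) (R (Suc n) x - R n x)} =
      prob {x\<in>space M. \<exists>k. R (Suc n) x = R n x + k \<and> ?Q (R n x) (B n x) k}"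
  proof (rule prob_eq_AE)
    show "AE x in M. Q (R n x) (B n x) (R (Suc n) x - R n x) \<longleftrightarrow>
        (\<exists>k. R (Suc n) x = R n x + k \<and> ?Q (R n x) (B n x) k)"
      using AE_regular
    proof eventually_elim
      case (elim x)
      then have "R (Suc n) x = R n x + (R (Suc n) x - R n x)" "R n x + B n x = total n" 
        by (metis le_add_diff_inverse, blast)
      then show ?case by (metis add_left_cancel)
    qed
  qed (rule sets_state_pred[of "\<lambda>r b s _. Q r b (s - r)" n "Suc n"]
        sets_state_pred[of "\<lambda>r b s _. \<exists>k. s = r + k \<and> ?Q r b k" n "Suc n"])+
  ultimately show ?thesis by simp
qed

end

subsection \<open>The weight \<open>exp (c n powr \<alpha>)\<close>\<close>

locale stretched_exp_urn =
  gpu_process M "\<lambda>n. exp (c * real n powr \<alpha>)" "\<lambda>n. nat \<lfloor>real n powr \<beta>\<rfloor>" R0 B0 R B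
  for M :: "'a measure" and c \<alpha> \<beta> :: real and R0 B0 :: nat and R B :: "nat \<Rightarrow> 'a \<Rightarrow> nat" +
  assumes c: "c > 0" and \<alpha>: "\<alpha> > 0" and \<beta>: "\<beta> > 0" and \<alpha>_\<beta>: "\<beta> > (1 - \<alpha>) / \<alpha>"
begin

definition draws :: "nat \<Rightarrow> nat" where
  "draws n = nat \<lfloor>real n powr \<beta>\<rfloor>"

definition \<kappa> :: real where
  "\<kappa> = \<alpha> * (\<beta> + 1) - 1"

text \<open>The hypothesis relating \<alpha> and \<beta>, multiplied by \<alpha>.\<close>

lemma \<kappa>_pos: "\<kappa> > 0"
  using \<alpha>_\<beta> \<alpha> by (simp add: \<kappa>_def field_simps)

text \<open>The factor \<open>1 / 2\<close> pays for the floor, which is at least 1.\<close>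

lemma draws_bounds:
  assumes "n \<ge> 1"
  shows "real n powr \<beta> / 2 \<le> real (draws n)" "real (draws n) \<le> real n powr \<beta>" "draws n > 0"
proof -
  have one: "real n powr \<beta> \<ge> 1" using assms \<beta> by (intro ge_one_powr_ge_zero) auto
  show "real n powr \<beta> / 2 \<le> real (draws n)" 
  proof -
    have "real (draws n) = real_of_int \<lfloor>real n powr \<beta>\<rfloor>" by (simp add: draws_def)
    moreover have "1 \<le> \<lfloor>real n powr \<beta>\<rfloor>" using one by simp
    ultimately show ?thesis by linarith
  qed
  show "real (draws n) \<le> real n powr \<beta>" unfolding draws_def by simp
  show "draws n > 0" unfolding draws_def using one by simp
qed

lemma total_eq: "total n = R0 + B0 + (\<Sum>i=1..n. draws i)"
  by (simp add: total_def draws_def)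

lemma total_le:
  assumes "n \<ge> 1"
  shows "real (total n) \<le> (real R0 + real B0 + 1) * real n powr (\<beta> + 1)"
proof -
  have one: "1 \<le> real n powr (\<beta> + 1)" using assms \<beta> by (intro ge_one_powr_ge_zero) auto
  have "(\<Sum>i=1..n. real (draws i)) \<le> (\<Sum>i=1..n. real n powr \<beta>)"
  proof (intro sum_mono)
    fix i assume "i \<in> {1..n}"
    then have "real (draws i) \<le> real i powr \<beta>" "real i powr \<beta> \<le> real n powr \<beta>"
      using \<beta> by (auto intro: draws_bounds powr_mono2)
    then show "real (draws i) \<le> real n powr \<beta>" by linarith
  qed
  also have "\<dots> = real n powr (\<beta> + 1)" using assms by (simp add: powr_add)
  moreover have "(real R0 + real B0) * 1 \<le> (real R0 + real B0) * real n powr (\<beta> + 1)"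
    using one by (intro mult_left_mono) auto
  ultimately show ?thesis by (simp add: total_eq distrib_right)
qed

text \<open>Only the steps after \<open>n div 2\<close> are counted: at least \<open>n / 2\<close>
  of them, each adding at least \<open>(n / 2) powr \<beta> / 2\<close> balls.\<close>

lemma total_ge:
  assumes "n \<ge> 1"
  shows "real n powr (\<beta> + 1) / (2 * 2 powr (\<beta> + 1)) \<le> real (total n)"
proof -
  have n: "real n > 0" using assms by simp
  have "real n powr (\<beta> + 1) / (2 * 2 powr (\<beta> + 1)) = (real n / 2) * ((real n / 2) powr \<beta> / 2)"
    using n by (simp add: powr_divide powr_add)
  also have "\<dots> \<le> real (card {n div 2 + 1..n}) * ((real n / 2) powr \<beta> / 2)"
  proof (intro mult_right_mono)
    have "real n / 2 \<le> real (n - n div 2)" by linarith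
    then show "real n / 2 \<le> real (card {n div 2 + 1..n})" by simp
  qed auto
  also have "\<dots> = (\<Sum>i\<in>{n div 2 + 1..n}. (real n / 2) powr \<beta> / 2)" by simp
  also have "\<dots> \<le> (\<Sum>i\<in>{n div 2 + 1..n}. real (draws i))"
  proof (intro sum_mono)
    fix i assume i: "i \<in> {n div 2 + 1..n}"
    then have "real n / 2 \<le> real i" by auto
    then have "(real n / 2) powr \<beta> / 2 \<le> real i powr \<beta> / 2" using \<beta> by (simp add: powr_mono2)
    also have "\<dots> \<le> real (draws i)" using i by (intro draws_bounds) auto
    finally show "(real n / 2) powr \<beta> / 2 \<le> real (draws i)" .
  qed
  also have "\<dots> \<le> (\<Sum>i=1..n. real (draws i))" by (intro sum_mono2) auto
  finally show ?thesis by (simp add: total_eq)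
qed

text \<open>The log-odds \<open>ln (w r / w b)\<close> of red for this weight.\<close>

definition bias :: "nat \<Rightarrow> nat \<Rightarrow> real" where
  "bias r b = c * (real r powr \<alpha> - real b powr \<alpha>)"

lemma bias_swap: "bias b r = - bias r b"
  by (simp add: bias_def algebra_simps)

lemma red_prob_eq: "red_prob r b = 1 / (1 + exp (- bias r b))"
  unfolding red_prob_def bias_def by (simp add: exp_diff exp_minus field_simps)

lemma red_prob_swap: "red_prob b r = 1 - red_prob r b"
  unfolding red_prob_def by (simp add: field_simps add_pos_pos add_nonneg_eq_0_iff)

lemma bias_nonneg: "b \<le> r \<Longrightarrow> bias r b \<ge> 0"
  unfolding bias_def using c \<alpha> by (simp add: powr_mono2)

lemma red_prob_ge: "b \<le> r \<Longrightarrow> red_prob r b \<ge> 1 / 2 + min 1 \<bar>bias r b\<bar> / 8"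
  unfolding red_prob_eq using logistic_ge[OF bias_nonneg] bias_nonneg by simp

lemma red_prob_le: "r \<le> b \<Longrightarrow> red_prob r b \<le> 1 / 2 - min 1 \<bar>bias r b\<bar> / 8"
  using red_prob_ge[of r b] unfolding red_prob_swap[of r b] bias_swap[of r b] by simp

lemma red_prob_compl_le: "b \<le> r \<Longrightarrow> 1 - red_prob r b \<le> exp (- \<bar>bias r b\<bar>)"
  unfolding red_prob_eq using logistic_compl_le[of "bias r b"] bias_nonneg[of b r] by simp

lemma red_prob_le_exp: "r \<le> b \<Longrightarrow> red_prob r b \<le> exp (- \<bar>bias r b\<bar>)"
  using red_prob_compl_le[of r b] unfolding red_prob_swap[of r b] bias_swap[of r b] by simp

text \<open>Apply \<open>powr_diff_ge\<close> with \<open>r + b = total n\<close>, which is of order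
  \<open>n powr (\<beta> + 1)\<close>, and note
  \<open>(\<beta> + 1) * (\<alpha> - 1) = \<kappa> - \<beta>\<close>. The constant is uniform in
  time and state.\<close>

lemma bias_ge:
  obtains a where "a > 0"
    "\<And>n r b. n \<ge> 1 \<Longrightarrow> r + b = total n \<Longrightarrow>
       a * real n powr (\<kappa> - \<beta>) * \<bar>real r - real b\<bar> \<le> \<bar>bias r b\<bar>"
proof -
  define c1 where "c1 = 1 / (2 * 2 powr (\<beta> + 1))"
  define c2 where "c2 = real R0 + real B0 + 1"
  define m where "m = min (c1 powr (\<alpha> - 1)) (c2 powr (\<alpha> - 1))"
  define k where "k = min \<alpha> (2 powr (1 - \<alpha>))"
  have c1: "c1 > 0" and c2: "c2 > 0" by (auto simp: c1_def c2_def)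
  have m: "m > 0" using c1 c2 by (auto simp: m_def)
  have k: "k > 0" using \<alpha> by (auto simp: k_def)
  have tot: "m * real n powr (\<kappa> - \<beta>) \<le> real (total n) powr (\<alpha> - 1)" if n: "n \<ge> 1" for n
  proof -
    have lo: "c1 * real n powr (\<beta> + 1) \<le> real (total n)"
      using total_ge[OF n] by (simp add: c1_def)
    have hi: "real (total n) \<le> c2 * real n powr (\<beta> + 1)" using total_le[OF n] by (simp add: c2_def)
    have pos: "c1 * real n powr (\<beta> + 1) > 0" using c1 n by simp
    have e: "(C * real n powr (\<beta> + 1)) powr (\<alpha> - 1) = C powr (\<alpha> - 1) * real n powr (\<kappa> - \<beta>)"
      if "C > 0" for C :: real
      using that by (simp add: powr_mult powr_powr \<kappa>_def algebra_simps)
    show ?thesis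
    \<comment> \<open>The sign of \<open>\<alpha> - 1\<close> decides whether the lower or the upper
      bound on \<open>total n\<close> matters; \<open>m\<close> serves both.\<close>
    proof (cases "\<alpha> \<ge> 1")
      case True
      have "m * real n powr (\<kappa> - \<beta>) \<le> c1 powr (\<alpha> - 1) * real n powr (\<kappa> - \<beta>)"
        by (intro mult_right_mono) (auto simp: m_def)
      also have "\<dots> \<le> real (total n) powr (\<alpha> - 1)"
        unfolding e[OF c1, symmetric] using lo pos True by (intro powr_mono2) auto
      finally show ?thesis .
    next
      case False
      have "m * real n powr (\<kappa> - \<beta>) \<le> c2 powr (\<alpha> - 1) * real n powr (\<kappa> - \<beta>)"
        by (intro mult_right_mono) (auto simp: m_def)
      also have "\<dots> \<le> real (total n) powr (\<alpha> - 1)"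
        unfolding e[OF c2, symmetric] using lo hi pos False by (intro powr_mono2') auto
      finally show ?thesis .
    qed
  qed
  have main: "c * k * m * real n powr (\<kappa> - \<beta>) * \<bar>real r - real b\<bar> \<le> \<bar>bias r b\<bar>"
    if n: "n \<ge> 1" and t: "r + b = total n" and le: "b \<le> r" for n r b
  proof -
    have "real (total n) > 0" using total_ge[OF n] n
      by (smt (verit) divide_pos_pos of_nat_0_less_iff powr_gt_zero less_le_trans zero_less_one)
    then have r: "real r > 0" using t le by auto
    have "k * (m * real n powr (\<kappa> - \<beta>)) * (real r - real b)
        \<le> k * (real (total n) powr (\<alpha> - 1)) * (real r - real b)"
      using tot[OF n] k le by (intro mult_right_mono mult_left_mono) auto
    also have "\<dots> \<le> real r powr \<alpha> - real b powr \<alpha>"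
      using powr_diff_ge[of "real b" "real r" \<alpha>] le r \<alpha> unfolding k_def t[symmetric] by simp
    finally have "c * (k * (m * real n powr (\<kappa> - \<beta>)) * (real r - real b)) \<le> bias r b"
      unfolding bias_def using c by (intro mult_left_mono) auto
    then show ?thesis using le by (simp add: mult_ac)
  qed
  show ?thesis
  proof (rule that[of "c * k * m"])
    show "c * k * m > 0" using c k m by simp
    fix n r b assume *: "n \<ge> (1::nat)" "r + b = total n"
    show "c * k * m * real n powr (\<kappa> - \<beta>) * \<bar>real r - real b\<bar> \<le> \<bar>bias r b\<bar>"
    proof (cases "b \<le> r")
      case False
      then show ?thesis using main[of n b r] * unfolding bias_swap[of r b] by (simp add: add.commute abs_minus_commute)
    qed (use main * in auto)
  qed
qed

end

subsection \<open>Growth of the imbalance and fixation\<close>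

lemma lim_enat_eventually_const:
  assumes "\<forall>\<^sub>F n in sequentially. f n = (k::nat)"
  shows "lim (\<lambda>n. enat (f n)) = enat k"
  using assms by (intro limI tendsto_eventually) (auto elim!: eventually_mono)

lemma tendsto_zero_sandwich:
  fixes f g :: "nat \<Rightarrow> real"
  assumes "\<forall>\<^sub>F n in sequentially. g n \<le> f n" "f \<longlonglongrightarrow> 0" "\<And>n. 0 \<le> g n"
  shows "g \<longlonglongrightarrow> 0"
  using assms by (intro tendsto_sandwich[OF _ assms(1) tendsto_const assms(2)]) auto

context stretched_exp_urn
begin

section \<open>Growth of the imbalance in probability\<close>

definition dev :: "nat \<Rightarrow> 'a \<Rightarrow> real" where
  "dev n x = \<bar>real (R n x) - real (B n x)\<bar>"

lemma dev_measurable [measurable]: "dev n \<in> borel_measurable M"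
  unfolding dev_def by measurable

text \<open>With \<open>k\<close> red draws the signed imbalance changes by
  \<open>2 * k - draws (Suc n)\<close>, so two consecutive imbalances are controlled by a binomial
  estimate.\<close>

lemma prob_dev_step_le:
  assumes P: "\<And>r b. r + b = total n \<Longrightarrow> t' \<le> \<bar>real r - real b\<bar> \<Longrightarrow>
      measure_pmf.prob (binomial_pmf (draws (Suc n)) (red_prob r b))
        {k. \<bar>real r - real b + 2 * real k - real (draws (Suc n))\<bar> < t} \<le> f"
    and f: "f \<ge> 0"
  shows "\<P>(x in M. t' \<le> dev n x \<and> dev (Suc n) x < t) \<le> f"
proof -
  let ?Q = "\<lambda>r b k. t' \<le> \<bar>real r - real b\<bar> \<and> \<bar>real r - real b + 2 * real k - real (draws (Suc n))\<bar> < t"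
  have "\<P>(x in M. t' \<le> dev n x \<and> dev (Suc n) x < t) = \<P>(x in M. ?Q (R n x) (B n x) (R (Suc n) x - R n x))"
  proof (rule prob_eq_AE)
    show "AE x in M. (t' \<le> dev n x \<and> dev (Suc n) x < t) = ?Q (R n x) (B n x) (R (Suc n) x - R n x)"
      using AE_regular
    proof eventually_elim
      case (elim x)
      then have r: "R n x \<le> R (Suc n) x" "R (Suc n) x - R n x \<le> draws (Suc n)"
        "B (Suc n) x = B n x + (draws (Suc n) - (R (Suc n) x - R n x))"
        unfolding draws_def by blast+
      then have "dev (Suc n) x =
          \<bar>real (R n x) - real (B n x) + 2 * real (R (Suc n) x - R n x) - real (draws (Suc n))\<bar>"
        unfolding dev_def by (simp add: of_nat_diff algebra_simps)
      then show ?case unfolding dev_def by simp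
    qed
  qed measurable
  also have "\<dots> \<le> f"
  proof (rule prob_step_le[OF _ f, where Q = ?Q])
    fix r b assume rb: "r + b = total n"
    show "measure_pmf.prob (binomial_pmf (nat \<lfloor>real (Suc n) powr \<beta>\<rfloor>) (red_prob r b)) {k. ?Q r b k} \<le> f"
      using P[OF rb] f unfolding draws_def by (cases "t' \<le> \<bar>real r - real b\<bar>") auto
  qed
  finally show ?thesis .
qed

text \<open>Convergence in probability, without a rate: later the imbalance only has to be large at
  infinitely many times.\<close>

definition spreads :: "real \<Rightarrow> bool" where
  "spreads \<theta> \<longleftrightarrow> (\<lambda>n. \<P>(x in M. dev n x < real n powr \<theta>)) \<longlonglongrightarrow> 0"

lemma eventually_Suc_draws:
  "\<forall>\<^sub>F n in sequentially. real n powr \<beta> / 2 \<le> real (draws (Suc n))"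
proof (rule eventually_sequentiallyI[of 1])
  fix n :: nat assume "n \<ge> 1"
  have "real n powr \<beta> \<le> real (Suc n) powr \<beta>" using \<beta> by (intro powr_mono2) auto
  then show "real n powr \<beta> / 2 \<le> real (draws (Suc n))"
    using draws_bounds(1)[of "Suc n"] by simp
qed

text \<open>One step suffices from any state. If \<open>red_prob\<close> lies between
  \<open>1 / 4\<close> and \<open>3 / 4\<close>, the small-ball bound applies with
  \<open>t n\<close> of smaller order than \<open>n powr (\<beta> / 2)\<close>; otherwise the
  advantage per draw is at least \<open>1 / 4\<close> and Hoeffding applies.\<close>

lemma spreads_sqrt:
  assumes \<theta>: "\<theta> < \<beta> / 2"
  shows "spreads \<theta>"
proof -
  define t where "t = (\<lambda>n. real (Suc n) powr \<theta>)"
  define f where "f = (\<lambda>n. 7 * (t n + 1) / sqrt (real n powr \<beta> / 2) + 2 * exp (- (real n powr \<beta> / 64)))"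
  have ev: "\<forall>\<^sub>F n in sequentially. t n \<le> real n powr \<beta> / 8"
    using \<theta> \<beta> unfolding t_def by real_asymp
  have "\<forall>\<^sub>F n in sequentially. \<P>(x in M. dev (Suc n) x < t n) \<le> f n"
    using ev eventually_Suc_draws eventually_gt_at_top[of 0]
  proof eventually_elim
    case (elim n)
    let ?s = "draws (Suc n)"
    have s: "?s > 0" by (rule draws_bounds) simp
    have np: "real n powr \<beta> > 0" using elim by simp
    have t0: "t n \<ge> 0" by (simp add: t_def)
    \<comment> \<open>The threshold 0 imposes no condition before the step.\<close>
    have "\<P>(x in M. 0 \<le> dev n x \<and> dev (Suc n) x < t n) \<le> f n"
    proof (rule prob_dev_step_le)
      fix r b :: nat
      let ?p = "red_prob r b"
      let ?K = "{k. \<bar>real r - real b + 2 * real k - real ?s\<bar> < t n}"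
      note p = less_imp_le[OF red_prob_pos[of r b]] less_imp_le[OF red_prob_less_1[of r b]]
      show "measure_pmf.prob (binomial_pmf ?s ?p) ?K \<le> f n"
      proof (cases "1 / 4 \<le> ?p \<and> ?p \<le> 3 / 4")
        case True
        then have "measure_pmf.prob (binomial_pmf ?s ?p) ?K \<le> 7 * (t n + 1) / sqrt (real ?s)"
          using s t0 by (intro binomial_small_ball) auto
        also have "\<dots> \<le> 7 * (t n + 1) / sqrt (real n powr \<beta> / 2)"
          using elim np s t0 by (intro divide_left_mono mult_pos_pos real_sqrt_le_mono) auto
        also have "\<dots> \<le> f n" by (simp add: f_def)
        finally show ?thesis .
      next
        case False
        \<comment> \<open>The majority colour has probability at least \<open>1 / 2\<close>, so
          outside the middle range it has more than \<open>3 / 4\<close>.\<close>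
        have 1: "?p \<ge> 1 / 2 + 1 / 4" if "real r - real b \<ge> 0"
          using red_prob_ge[of b r] that False by auto
        have 2: "?p \<le> 1 / 2 - 1 / 4" if "real r - real b \<le> 0"
          using red_prob_le[of r b] that False by auto
        have "measure_pmf.prob (binomial_pmf ?s ?p) ?K \<le>
            measure_pmf.prob (binomial_pmf ?s ?p) {k. \<bar>real r - real b + 2 * real k - real ?s\<bar> < 1 / 4 * real ?s}"
          using elim by (intro measure_pmf.finite_measure_mono) auto
        also have "\<dots> \<le> 2 * exp (- ((1 / 4)\<^sup>2 * real ?s / 2))"
          using p s 1 2 by (intro binomial_advantage) auto
        also have "\<dots> \<le> 2 * exp (- (real n powr \<beta> / 64))"
          using elim by (simp add: power2_eq_square)
        also have "\<dots> \<le> f n" using t0 by (simp add: f_def)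
        finally show ?thesis .
      qed
    qed (use t0 in \<open>simp add: f_def\<close>)
    then show ?case by (simp add: dev_def)
  qed
  moreover have "f \<longlonglongrightarrow> 0"
  proof -
    have "(\<lambda>n. real (Suc n) powr \<theta> / sqrt (real n powr \<beta> / 2)) \<longlonglongrightarrow> 0"
      using \<theta> \<beta> by real_asymp
    moreover have "(\<lambda>n. 1 / sqrt (real n powr \<beta> / 2)) \<longlonglongrightarrow> 0"
      using \<beta> by real_asymp
    moreover have "(\<lambda>n. exp (- (real n powr \<beta> / 64))) \<longlonglongrightarrow> 0"
      using \<beta> by real_asymp
    ultimately have "(\<lambda>n. 7 * (real (Suc n) powr \<theta> / sqrt (real n powr \<beta> / 2)) + 7 * (1 / sqrt (real n powr \<beta> / 2))
        + 2 * exp (- (real n powr \<beta> / 64))) \<longlonglongrightarrow> 7 * 0 + 7 * 0 + 2 * 0"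
      by (intro tendsto_intros)
    then show ?thesis by (simp add: f_def t_def add_divide_distrib distrib_left)
  qed
  ultimately have "(\<lambda>n. \<P>(x in M. dev (Suc n) x < t n)) \<longlonglongrightarrow> 0"
    by (rule tendsto_zero_sandwich) (rule measure_nonneg)
  then show ?thesis
    unfolding spreads_def t_def by (subst filterlim_sequentially_Suc[symmetric])
qed

text \<open>An imbalance \<open>n powr \<theta>\<close> gives an advantage of order
  \<open>n powr (\<kappa> - \<beta> + \<theta>)\<close> per draw, capped at a constant, hence a gain
  of order \<open>n powr (\<kappa> + \<theta>)\<close> or \<open>n powr \<beta>\<close>; this
  explains the two bounds on \<open>\<theta>'\<close>. The condition on \<theta> makes the Hoeffding
  exponent, advantage squared times \<open>n powr \<beta>\<close>, diverge.\<close>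

lemma spreads_step:
  assumes sp: "spreads \<theta>" and \<theta>: "2 * \<kappa> - \<beta> + 2 * \<theta> > 0" and \<theta>': "\<theta>' < \<beta>" "\<theta>' < \<kappa> + \<theta>"
  shows "spreads \<theta>'"
proof -
  obtain a where a: "a > 0" and
    bias: "\<And>n r b. n \<ge> 1 \<Longrightarrow> r + b = total n \<Longrightarrow>
       a * real n powr (\<kappa> - \<beta>) * \<bar>real r - real b\<bar> \<le> \<bar>bias r b\<bar>"
    by (rule bias_ge) (erule that, simp)
  define t where "t = (\<lambda>n. real (Suc n) powr \<theta>')"
  \<comment> \<open>The advantage per draw; cap and factor \<open>1 / 8\<close> come from
    \<open>logistic_ge\<close>.\<close>
  define g where "g = (\<lambda>n. min 1 (a * real n powr (\<kappa> - \<beta> + \<theta>)) / 8)"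
  define f where "f = (\<lambda>n. 2 * exp (- ((g n)\<^sup>2 * (real n powr \<beta> / 2) / 2)))"
  have "\<forall>\<^sub>F n in sequentially. t n \<le> real n powr \<beta> / 16"
    using \<theta>' \<beta> unfolding t_def by real_asymp
  moreover have "\<forall>\<^sub>F n in sequentially. t n \<le> a * real n powr (\<kappa> + \<theta>) / 16"
    using \<theta>' \<beta> a unfolding t_def by real_asymp
  ultimately have ev: "\<forall>\<^sub>F n in sequentially. t n \<le> g n * (real n powr \<beta> / 2)"
  proof eventually_elim
    case (elim n)
    have "a * real n powr (\<kappa> + \<theta>) = a * real n powr (\<kappa> - \<beta> + \<theta>) * real n powr \<beta>"
      by (simp add: powr_add[symmetric])
    then show ?case using elim a by (auto simp: g_def min_def field_simps)
  qed
  have "\<forall>\<^sub>F n in sequentially. \<P>(x in M. real n powr \<theta> \<le> dev n x \<and> dev (Suc n) x < t n) \<le> f n"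
    using ev eventually_Suc_draws eventually_gt_at_top[of 0]
  proof eventually_elim
    case (elim n)
    let ?s = "draws (Suc n)"
    have s: "?s > 0" by (rule draws_bounds) simp
    have g0: "g n \<ge> 0" using a by (simp add: g_def)
    show ?case
    proof (rule prob_dev_step_le)
      fix r b :: nat
      assume rb: "r + b = total n" and d: "real n powr \<theta> \<le> \<bar>real r - real b\<bar>"
      let ?p = "red_prob r b"
      let ?K = "{k. \<bar>real r - real b + 2 * real k - real ?s\<bar> < t n}"
      note p = less_imp_le[OF red_prob_pos[of r b]] less_imp_le[OF red_prob_less_1[of r b]]
      have "a * real n powr (\<kappa> - \<beta> + \<theta>) = a * real n powr (\<kappa> - \<beta>) * real n powr \<theta>"
        by (simp add: powr_add)
      also have "\<dots> \<le> a * real n powr (\<kappa> - \<beta>) * \<bar>real r - real b\<bar>"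
        using d a by (intro mult_left_mono) auto
      also have "\<dots> \<le> \<bar>bias r b\<bar>" using elim rb by (intro bias) auto
      finally have g: "g n \<le> min 1 \<bar>bias r b\<bar> / 8" by (simp add: g_def)
      have 1: "?p \<ge> 1 / 2 + g n" if "real r - real b \<ge> 0"
        using red_prob_ge[of b r] that g by auto
      have 2: "?p \<le> 1 / 2 - g n" if "real r - real b \<le> 0"
        using red_prob_le[of r b] that g by auto
      have "g n * (real n powr \<beta> / 2) \<le> g n * real ?s" using elim g0 by (intro mult_left_mono) auto
      then have "measure_pmf.prob (binomial_pmf ?s ?p) ?K \<le>
          measure_pmf.prob (binomial_pmf ?s ?p) {k. \<bar>real r - real b + 2 * real k - real ?s\<bar> < g n * real ?s}"
        using elim by (intro measure_pmf.finite_measure_mono) auto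
      also have "\<dots> \<le> 2 * exp (- ((g n)\<^sup>2 * real ?s / 2))"
        using p s g0 1 2 by (intro binomial_advantage) auto
      also have "\<dots> \<le> f n"
      proof -
        have "(g n)\<^sup>2 * (real n powr \<beta> / 2) \<le> (g n)\<^sup>2 * real ?s" using elim by (intro mult_left_mono) auto
        then show ?thesis by (simp add: f_def mult.commute)
      qed
      finally show "measure_pmf.prob (binomial_pmf ?s ?p) ?K \<le> f n" .
    qed (simp add: f_def)
  qed
  moreover have "f \<longlonglongrightarrow> 0"
  proof -
    \<comment> \<open>The capped and the uncapped value of \<open>g\<close> give these two
      exponents, with \<open>256 = 8 ^ 2 * 2 * 2\<close>.\<close>
    have "filterlim (\<lambda>n. real n powr \<beta> / 256) at_top sequentially" using \<beta> by real_asymp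
    moreover have "filterlim (\<lambda>n. a\<^sup>2 * real n powr (2 * \<kappa> - \<beta> + 2 * \<theta>) / 256) at_top sequentially"
    proof -
      have "a\<^sup>2 > 0" using a by simp
      then show ?thesis using \<theta> by real_asymp
    qed
    ultimately have "filterlim (\<lambda>n. min (real n powr \<beta> / 256) (a\<^sup>2 * real n powr (2 * \<kappa> - \<beta> + 2 * \<theta>) / 256))
        at_top sequentially"
      unfolding filterlim_at_top by (auto simp: eventually_conj_iff)
    moreover have "min (real n powr \<beta> / 256) (a\<^sup>2 * real n powr (2 * \<kappa> - \<beta> + 2 * \<theta>) / 256) =
        (g n)\<^sup>2 * (real n powr \<beta> / 2) / 2" for n
    proof -
      have e: "(a * real n powr (\<kappa> - \<beta> + \<theta>))\<^sup>2 * real n powr \<beta> = a\<^sup>2 * real n powr (2 * \<kappa> - \<beta> + 2 * \<theta>)"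
        by (simp add: power_mult_distrib power2_eq_square powr_add[symmetric] algebra_simps)
      define y where "y = a * real n powr (\<kappa> - \<beta> + \<theta>)"
      have y: "y \<ge> 0" using a by (simp add: y_def)
      have "(min 1 y)\<^sup>2 * real n powr \<beta> = min (real n powr \<beta>) (y\<^sup>2 * real n powr \<beta>)"
      proof (cases "y \<le> 1")
        case True
        then have "y\<^sup>2 \<le> 1" using y by (simp add: power_le_one)
        then have "y\<^sup>2 * real n powr \<beta> \<le> 1 * real n powr \<beta>" by (intro mult_right_mono) auto
        then show ?thesis using True by simp
      next
        case False
        then have "1 \<le> y\<^sup>2" by (simp add: one_le_power)
        then have "1 * real n powr \<beta> \<le> y\<^sup>2 * real n powr \<beta>" by (intro mult_right_mono) auto
        then show ?thesis using False by simp
      qed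
      then show ?thesis unfolding g_def y_def e by (simp add: power_divide min_def)
    qed
    ultimately have "filterlim (\<lambda>n. (g n)\<^sup>2 * (real n powr \<beta> / 2) / 2) at_top sequentially" by simp
    then have "(\<lambda>n. exp (- ((g n)\<^sup>2 * (real n powr \<beta> / 2) / 2))) \<longlonglongrightarrow> 0"
      by (intro filterlim_compose[OF exp_at_bot] filterlim_compose[OF filterlim_uminus_at_bot_at_top])
    from tendsto_mult_left[OF this, of 2] show ?thesis by (simp add: f_def)
  qed
  ultimately have lim: "(\<lambda>n. \<P>(x in M. real n powr \<theta> \<le> dev n x \<and> dev (Suc n) x < t n)) \<longlonglongrightarrow> 0"
    by (rule tendsto_zero_sandwich) (rule measure_nonneg)
  have "(\<lambda>n. \<P>(x in M. dev (Suc n) x < t n)) \<longlonglongrightarrow> 0"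
  proof (rule tendsto_zero_sandwich)
    show "(\<lambda>n. \<P>(x in M. dev n x < real n powr \<theta>) +
        \<P>(x in M. real n powr \<theta> \<le> dev n x \<and> dev (Suc n) x < t n)) \<longlonglongrightarrow> 0"
      using tendsto_add[OF sp[unfolded spreads_def] lim] by simp
    show "\<forall>\<^sub>F n in sequentially. \<P>(x in M. dev (Suc n) x < t n) \<le> \<P>(x in M. dev n x < real n powr \<theta>) +
        \<P>(x in M. real n powr \<theta> \<le> dev n x \<and> dev (Suc n) x < t n)"
    proof (rule always_eventually, rule allI)
      fix n
      have "\<P>(x in M. dev (Suc n) x < t n) \<le> prob ({x\<in>space M. dev n x < real n powr \<theta>} \<union>
          {x\<in>space M. real n powr \<theta> \<le> dev n x \<and> dev (Suc n) x < t n})"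
        by (intro finite_measure_mono) auto
      also have "\<dots> \<le> \<P>(x in M. dev n x < real n powr \<theta>) +
          \<P>(x in M. real n powr \<theta> \<le> dev n x \<and> dev (Suc n) x < t n)"
        by (intro measure_Un_le) auto
      finally show "\<P>(x in M. dev (Suc n) x < t n) \<le> \<dots>" .
    qed
  qed auto
  then show ?thesis
    unfolding spreads_def t_def by (subst filterlim_sequentially_Suc[symmetric])
qed

text \<open>Starting below \<open>\<beta> / 2\<close> with \<open>spreads_sqrt\<close>, each use of
  \<open>spreads_step\<close> raises the exponent by \<epsilon>.\<close>

lemma spreads_less:
  assumes "\<theta> < \<beta>"
  shows "spreads \<theta>"
proof -
  \<comment> \<open>Small enough that for \<open>\<theta> > \<beta> / 2 - \<epsilon>\<close> the
    condition of \<open>spreads_step\<close> holds at \<open>\<theta> - \<epsilon>\<close>: \<open>2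
    * \<kappa> - \<beta> + 2 * (\<theta> - \<epsilon>) > 2 * \<kappa> - 4 * \<epsilon> >
    0\<close>.\<close>
  define \<epsilon> where "\<epsilon> = min \<kappa> \<beta> / 4"
  have \<epsilon>: "\<epsilon> > 0" "4 * \<epsilon> \<le> \<kappa>" "4 * \<epsilon> \<le> \<beta>" using \<kappa>_pos \<beta> by (auto simp: \<epsilon>_def)
  have "spreads \<theta>" if "\<theta> < \<beta>" "\<theta> \<le> \<beta> / 2 - \<epsilon> + real j * \<epsilon>" for j \<theta>
    using that
  proof (induction j arbitrary: \<theta>)
    case 0
    then show ?case using \<epsilon> by (intro spreads_sqrt) auto
  next
    case (Suc j)
    show ?case
    \<comment> \<open>Exponents not yet reached after \<open>j\<close> steps exceed
      \<open>\<beta> / 2 - \<epsilon>\<close>.\<close>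
    proof (cases "\<theta> \<le> \<beta> / 2 - \<epsilon> + real j * \<epsilon>")
      case True
      then show ?thesis using Suc by blast
    next
      case False
      have "0 \<le> real j * \<epsilon>" using \<epsilon> by simp
      have "spreads (\<theta> - \<epsilon>)" using Suc.prems \<epsilon> by (intro Suc.IH) (auto simp: algebra_simps)
      moreover have "2 * \<kappa> - \<beta> + 2 * (\<theta> - \<epsilon>) > 0"
      proof -
        have "\<beta> / 2 - \<epsilon> < \<theta>" using False \<open>0 \<le> real j * \<epsilon>\<close> by linarith
        then have "\<beta> < 2 * \<theta> + 2 * \<epsilon>" by simp
        then show ?thesis using \<epsilon>(1,2) unfolding right_diff_distrib by linarith
      qed
      moreover have "\<theta> < \<kappa> + (\<theta> - \<epsilon>)" using \<epsilon> by linarith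
      ultimately show ?thesis using Suc.prems(1) spreads_step by blast
    qed
  qed
  moreover obtain j where "real j \<ge> (\<theta> - \<beta> / 2 + \<epsilon>) / \<epsilon>" using real_arch_simple by blast
  then have "\<theta> \<le> \<beta> / 2 - \<epsilon> + real j * \<epsilon>" using \<epsilon> by (simp add: field_simps)
  ultimately show ?thesis using assms by blast
qed

section \<open>Almost sure fixation\<close>

text \<open>The event that the imbalance stays small from \<open>N\<close> on lies in each event
  \<open>dev n x < n powr \<theta>\<close> with \<open>n \<ge> N\<close>, whose probabilities tend
  to 0; so it is null.\<close>

lemma AE_dev_large:
  assumes "spreads \<theta>"
  shows "AE x in M. \<forall>N. \<exists>n\<ge>N. real n powr \<theta> \<le> dev n x"
  unfolding AE_all_countable
proof
  fix N
  let ?E = "{x\<in>space M. \<forall>n\<ge>N. dev n x < real n powr \<theta>}"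
  have E: "?E \<in> events" by measurable
  have "prob ?E \<le> 0"
  proof (rule tendsto_lowerbound[OF assms[unfolded spreads_def]])
    show "\<forall>\<^sub>F n in sequentially. prob ?E \<le> \<P>(x in M. dev n x < real n powr \<theta>)"
      using eventually_ge_at_top[of N]
      by eventually_elim (intro finite_measure_mono, auto)
  qed auto
  then have "prob ?E = 0" by (simp add: measure_le_0_iff)
  then have "AE x in M. \<not> (\<forall>n\<ge>N. dev n x < real n powr \<theta>)"
    using E by (subst (asm) prob_Collect_eq_0) auto
  then show "AE x in M. \<exists>n\<ge>N. real n powr \<theta> \<le> dev n x"
    by eventually_elim (auto simp: not_less)
qed

text \<open>Above the threshold the log-odds are at least \<open>a * n powr \<mu>\<close> in size
  with \<open>\<mu> > 0\<close>, so the minority gets a ball with probability at most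
  \<open>f n\<close>, which is summable. The threshold is part of the failure event, so
  Borel-Cantelli applies however often it is met.\<close>

lemma AE_majority_takes_all:
  assumes \<theta>: "\<theta> > \<beta> - \<kappa>"
  shows "AE x in M. \<forall>\<^sub>F n in sequentially. real n powr \<theta> \<le> dev n x \<longrightarrow>
           R (Suc n) x - R n x = (if B n x \<le> R n x then draws (Suc n) else 0)"
proof -
  obtain a where a: "a > 0" and
    bias: "\<And>n r b. n \<ge> 1 \<Longrightarrow> r + b = total n \<Longrightarrow>
       a * real n powr (\<kappa> - \<beta>) * \<bar>real r - real b\<bar> \<le> \<bar>bias r b\<bar>"
    by (rule bias_ge) (erule that, simp)
  define \<mu> where "\<mu> = \<kappa> - \<beta> + \<theta>"
  have \<mu>: "\<mu> > 0" using \<theta> by (simp add: \<mu>_def)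
  let ?F = "\<lambda>n. {x\<in>space M. \<not> (real n powr \<theta> \<le> dev n x \<longrightarrow>
           R (Suc n) x - R n x = (if B n x \<le> R n x then draws (Suc n) else 0))}"
  define f where "f = (\<lambda>n. real (Suc n) powr \<beta> * exp (- (a * real n powr \<mu>)))"
  have F: "prob (?F n) \<le> f n" if n: "n \<ge> 1" for n
  proof -
    \<comment> \<open>A tie is counted as a red majority, but for \<open>n \<ge> 1\<close> it never
      meets the positive threshold.\<close>
    let ?Q = "\<lambda>r b k. real n powr \<theta> \<le> \<bar>real r - real b\<bar> \<and> k \<noteq> (if b \<le> r then draws (Suc n) else 0)"
    have "prob (?F n) = \<P>(x in M. ?Q (R n x) (B n x) (R (Suc n) x - R n x))"
      by (intro arg_cong[where f = prob]) (auto simp: dev_def)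
    also have "\<dots> \<le> f n"
    proof (rule prob_step_le[where Q = ?Q])
      fix r b assume rb: "r + b = total n"
      let ?B = "binomial_pmf (draws (Suc n)) (red_prob r b)"
      note p = less_imp_le[OF red_prob_pos[of r b]] less_imp_le[OF red_prob_less_1[of r b]]
      have "measure_pmf.prob ?B {k. ?Q r b k} \<le> f n"
      proof (cases "real n powr \<theta> \<le> \<bar>real r - real b\<bar>")
        case True
        have "a * real n powr \<mu> = a * real n powr (\<kappa> - \<beta>) * real n powr \<theta>"
          by (simp add: \<mu>_def powr_add)
        also have "\<dots> \<le> a * real n powr (\<kappa> - \<beta>) * \<bar>real r - real b\<bar>"
          using True a by (intro mult_left_mono) auto
        also have "\<dots> \<le> \<bar>bias r b\<bar>" using n rb by (intro bias) auto
        finally have e: "exp (- \<bar>bias r b\<bar>) \<le> exp (- (a * real n powr \<mu>))" by simp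
        have "measure_pmf.prob ?B {k. ?Q r b k} \<le>
            measure_pmf.prob ?B {k. k \<noteq> (if b \<le> r then draws (Suc n) else 0)}"
          by (intro measure_pmf.finite_measure_mono) auto
        also have "\<dots> \<le> real (draws (Suc n)) * exp (- \<bar>bias r b\<bar>)"
        proof (cases "b \<le> r")
          case True
          then show ?thesis
            using binomial_prob_not_all(1)[OF p, of "draws (Suc n)"]
              mult_left_mono[OF red_prob_compl_le[OF True], of "real (draws (Suc n))"] by simp
        next
          case False
          then show ?thesis
            using binomial_prob_not_all(2)[OF p, of "draws (Suc n)"]
              mult_left_mono[OF red_prob_le_exp[of r b], of "real (draws (Suc n))"] by simp
        qed
        also have "\<dots> \<le> f n"
          unfolding f_def using e draws_bounds(2)[of "Suc n"] by (intro mult_mono) auto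
        finally show ?thesis .
      qed (simp add: f_def)
      then show "measure_pmf.prob (binomial_pmf (nat \<lfloor>real (Suc n) powr \<beta>\<rfloor>) (red_prob r b)) {k. ?Q r b k} \<le> f n"
        by (simp only: draws_def)
    qed (simp add: f_def)
    finally show ?thesis .
  qed
  have "\<forall>\<^sub>F n in sequentially. f n \<le> 1 / real n ^ 2"
    using \<mu> a \<beta> unfolding f_def by real_asymp
  with eventually_ge_at_top[of 1]
  have "\<forall>\<^sub>F n in sequentially. norm (prob (?F n)) \<le> 1 / real n ^ 2"
    proof eventually_elim
    case (elim n)
    then show ?case using order_trans[OF F[of n] elim(2)] by simp
  qed
  moreover have "summable (\<lambda>n. 1 / real n ^ 2)"
    using inverse_power_summable[of 2] by (simp add: inverse_eq_divide)
  ultimately have "summable (\<lambda>n. prob (?F n))"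
    by (rule summable_comparison_test_ev)
  then have "AE x in M. \<forall>\<^sub>F n in sequentially. x \<in> space M - ?F n"
    by (intro borel_cantelli_AE1) (auto simp: emeasure_eq_measure)
  then show ?thesis
    by (auto elim!: eventually_mono)
qed

text \<open>At a late time with large imbalance the majority takes all draws. These alone exceed the
  next threshold, so the situation repeats forever and the minority count is frozen.\<close>

lemma AE_fixation:
  "AE x in M. lim (\<lambda>n. enat (R n x)) < \<infinity> \<or> lim (\<lambda>n. enat (B n x)) < \<infinity>"
proof -
  \<comment> \<open>The lower bound serves \<open>AE_majority_takes_all\<close>, the upper one
    \<open>spreads_less\<close>; \<open>\<kappa> > 0\<close> leaves room between them.\<close>
  obtain \<theta> where \<theta>: "\<theta> > \<beta> - \<kappa>" "\<theta> < \<beta>"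
    using dense[of "\<beta> - \<kappa>" \<beta>] \<kappa>_pos by auto
  have ev: "\<forall>\<^sub>F n in sequentially. real (Suc n) powr \<theta> \<le> real (draws (Suc n))"
  proof -
    have "\<forall>\<^sub>F n in sequentially. real (Suc n) powr \<theta> \<le> real n powr \<beta> / 2"
      using \<theta> \<beta> by real_asymp
    then show ?thesis using eventually_Suc_draws by eventually_elim simp
  qed
  show ?thesis
    using AE_regular AE_majority_takes_all[OF \<theta>(1)] AE_dev_large[OF spreads_less[OF \<theta>(2)]]
  proof eventually_elim
    case (elim x)
    have reg: "R n x \<le> R (Suc n) x" "B (Suc n) x = B n x + (draws (Suc n) - (R (Suc n) x - R n x))" for n
      using elim(1) unfolding draws_def by blast+
    from eventually_conj[OF elim(2) ev] obtain m where
      m: "\<And>n. n \<ge> m \<Longrightarrow> real n powr \<theta> \<le> dev n x \<Longrightarrow>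
           R (Suc n) x - R n x = (if B n x \<le> R n x then draws (Suc n) else 0)"
         "\<And>n. n \<ge> m \<Longrightarrow> real (Suc n) powr \<theta> \<le> real (draws (Suc n))"
      unfolding eventually_sequentially by blast
    \<comment> \<open>Large imbalances recur infinitely often, so one occurs after \<open>m\<close>;
      it starts the induction.\<close>
    obtain n where n: "n \<ge> m" "real n powr \<theta> \<le> dev n x" using elim(3) by blast
    show ?case
    proof (cases "B n x \<le> R n x")
      case True
      have inv: "B i x \<le> R i x \<and> real i powr \<theta> \<le> dev i x \<and> B i x = B n x" if "i \<ge> n" for i
        using that
      proof (induction i rule: dec_induct)
        case (step i)
        then have "R (Suc i) x - R i x = draws (Suc i)" using m(1)[of i] n by auto
        then have R: "R (Suc i) x = R i x + draws (Suc i)" and B: "B (Suc i) x = B i x"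
          using reg[of i] by simp_all
        \<comment> \<open>The lead of red was nonnegative and grew by
          \<open>draws (Suc i)\<close>.\<close>
        have "real (Suc i) powr \<theta> \<le> dev (Suc i) x"
          using m(2)[of i] step n unfolding dev_def R B by simp
        then show ?case using step R B by simp
      qed (use True n in auto)
      have "lim (\<lambda>i. enat (B i x)) = enat (B n x)"
        by (intro lim_enat_eventually_const eventually_sequentiallyI[of n]) (drule inv, elim conjE)
      then show ?thesis by simp
    next
      case False
      have inv: "R i x < B i x \<and> real i powr \<theta> \<le> dev i x \<and> R i x = R n x" if "i \<ge> n" for i
        using that
      proof (induction i rule: dec_induct)
        case (step i)
        then have "R (Suc i) x - R i x = 0" using m(1)[of i] n by auto
        then have R: "R (Suc i) x = R i x" and B: "B (Suc i) x = B i x + draws (Suc i)"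
          using reg[of i] by simp_all
        have "real (Suc i) powr \<theta> \<le> dev (Suc i) x"
          using m(2)[of i] step n unfolding dev_def R B by simp
        then show ?case using step R B by simp
      qed (use False n in auto)
      have "lim (\<lambda>i. enat (R i x)) = enat (R n x)"
        by (intro lim_enat_eventually_const eventually_sequentiallyI[of n]) (drule inv, elim conjE)
      then show ?thesis by simp
    qed
  qed
qed

text \<open>Measurability of the event has to be checked, since a non-measurable set has measure 0
  by convention.\<close>

lemma prob_fixation:
  "\<P>(x in M. lim (\<lambda>n. enat (R n x)) < \<infinity> \<or> lim (\<lambda>n. enat (B n x)) < \<infinity>) = 1"
proof -
  have [measurable]: "(\<lambda>x. enat (R n x)) \<in> borel_measurable M" "(\<lambda>x. enat (B n x)) \<in> borel_measurable M" for n
    by (rule measurable_compose[OF R_measurable], simp) (rule measurable_compose[OF B_measurable], simp)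
  have "{x\<in>space M. lim (\<lambda>n. enat (R n x)) < \<infinity> \<or> lim (\<lambda>n. enat (B n x)) < \<infinity>} \<in> events"
    by measurable
  then show ?thesis using AE_fixation by (simp add: prob_Collect_eq_1)
qed

end

theorem theorem1p2:
  fixes c \<alpha> \<beta> :: real
    and R0 B0 :: nat
    and M :: "'a measure"
    and R B :: "nat \<Rightarrow> 'a \<Rightarrow> nat"
  assumes "c > 0" and "\<alpha> > 0" and "\<beta> > 0"
    and "\<beta> > (1 - \<alpha>) / \<alpha>"
    and "gpu_process M (\<lambda>n. exp (c * real n powr \<alpha>)) (\<lambda>n. nat \<lfloor>real n powr \<beta>\<rfloor>) R0 B0 R B"
  shows "\<P>(x in M. lim (\<lambda>n. enat (R n x)) < \<infinity> \<or> lim (\<lambda>n. enat (B n x)) < \<infinity>) = 1"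
proof -
  interpret stretched_exp_urn M c \<alpha> \<beta> R0 B0 R B
    using assms by (intro stretched_exp_urn.intro stretched_exp_urn_axioms.intro)
  show ?thesis by (rule prob_fixation)
qed

end
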